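(* Let $\mathbf{H}$ be a Hadamard matrix of order $n$. Then $$\sigma([\mathbf{H}])=\|\mathbf{H}\|_{\infty,1}.$$
   Context: A Hadamard matrix of order $n$ is an $n\times n$ matrix with entries in $\{+1,-1\}$ whose rows are mutually orthogonal. The excess $\sigma(\mathbf{H})$ of a Hadamard matrix is the sum of all its entries; for a set $\mathcal{S}$ of Hadamard matrices of order $n$, $\sigma(\mathcal{S})=\max\{\sigma(\mathbf{A}):\mathbf{A}\in\mathcal{S}\}$. Two Hadamard matrices are equivalent if one can be obtained from the other by permuting rows, permuting columns, and multiplying rows and columns by $-1$; $[\mathbf{H}]$ denotes the equivalence class of $\mathbf{H}$. For a real $n\times n$ matrix $\mathbf{A}$, $\|\mathbf{A}\|_{\infty,1}=\sup_{\mathbf{x}\neq 0}\|\mathbf{A}\mathbf{x}\|_1/\|\mathbf{x}\|_\infty$, where $\|\mathbf{v}\|_1=\sum_i|v_i|$ and $\|\mathbf{v}\|_\infty=\max_i|v_i|$. *)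

theory Defs
  imports "HOL-Analysis.Analysis"
begin

text \<open>Matrices of order \<open>n\<close> have type \<open>real ^ 'n ^ 'n\<close> with \<open>n = CARD('n)\<close>.\<close>

definition hadamard_matrix :: "real ^ 'n ^ 'n \<Rightarrow> bool" where
  "hadamard_matrix A \<longleftrightarrow>
     (\<forall>i j. A $ i $ j \<in> {1, -1}) \<and>
     (\<forall>i k. i \<noteq> k \<longrightarrow> orthogonal (row i A) (row k A))"

definition excess :: "real ^ 'n ^ 'n \<Rightarrow> real" where
  "excess A = (\<Sum>i\<in>UNIV. \<Sum>j\<in>UNIV. A $ i $ j)"

text \<open>Only meaningful for nonempty sets of Hadamard matrices; these are finite by
  \<open>finite_hadamard_matrices\<close>, so that the maximum exists.\<close>

definition max_excess :: "(real ^ 'n ^ 'n) set \<Rightarrow> real" where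
  "max_excess S = Max (excess ` S)"

inductive hadamard_equiv :: "real ^ 'n ^ 'n \<Rightarrow> real ^ 'n ^ 'n \<Rightarrow> bool" for A where
  refl: "hadamard_equiv A A"
| permute_rows:
    "hadamard_equiv A B \<Longrightarrow> p permutes UNIV \<Longrightarrow> hadamard_equiv A (\<chi> i j. B $ p i $ j)"
| permute_columns:
    "hadamard_equiv A B \<Longrightarrow> p permutes UNIV \<Longrightarrow> hadamard_equiv A (\<chi> i j. B $ i $ p j)"
| negate_row:
    "hadamard_equiv A B \<Longrightarrow> hadamard_equiv A (\<chi> i j. if i = k then - B $ i $ j else B $ i $ j)"
| negate_column:
    "hadamard_equiv A B \<Longrightarrow> hadamard_equiv A (\<chi> i j. if j = k then - B $ i $ j else B $ i $ j)"

definition hadamard_class :: "real ^ 'n ^ 'n \<Rightarrow> (real ^ 'n ^ 'n) set" where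
  "hadamard_class A = {B. hadamard_matrix B \<and> hadamard_equiv A B}"

definition l1_norm :: "real ^ 'n \<Rightarrow> real" where
  "l1_norm v = (\<Sum>i\<in>UNIV. \<bar>v $ i\<bar>)"

text \<open>The maximum norm is the library's \<open>infnorm\<close>, see \<open>infnorm_eq_Max\<close>.\<close>

definition inf_one_norm :: "real ^ 'n ^ 'n \<Rightarrow> real" where
  "inf_one_norm A = (SUP x\<in>{x. x \<noteq> 0}. l1_norm (A *v x) / infnorm x)"

lemma infnorm_eq_Max: "infnorm (v :: real ^ 'n) = Max (range (\<lambda>i. \<bar>v $ i\<bar>))"
proof -
  have "{\<bar>v $ i\<bar> |i. i \<in> UNIV} = range (\<lambda>i. \<bar>v $ i\<bar>)" by auto
  then show ?thesis
    unfolding infnorm_cart by (simp add: cSup_eq_Max)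
qed

text \<open>The supremum in \<open>inf_one_norm\<close> is over a nonempty set that is bounded above.\<close>

lemma inf_one_norm_nonempty: "{x :: real ^ 'n. x \<noteq> 0} \<noteq> {}"
  using zero_neq_one by blast

lemma inf_one_norm_bdd_above:
  fixes A :: "real ^ 'n ^ 'n"
  shows "bdd_above ((\<lambda>x. l1_norm (A *v x) / infnorm x) ` {x. x \<noteq> 0})"
proof (rule bdd_aboveI2)
  fix x :: "real ^ 'n"
  assume "x \<in> {x. x \<noteq> 0}"
  then have pos: "infnorm x > 0" by (simp add: infnorm_pos_lt)
  have "\<bar>(A *v x) $ i\<bar> \<le> (\<Sum>j\<in>UNIV. \<bar>A $ i $ j\<bar>) * infnorm x" for i
  proof -
    have "\<bar>(A *v x) $ i\<bar> \<le> (\<Sum>j\<in>UNIV. \<bar>A $ i $ j * x $ j\<bar>)"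
      unfolding matrix_vector_mult_def by (simp add: sum_abs)
    also have "\<dots> \<le> (\<Sum>j\<in>UNIV. \<bar>A $ i $ j\<bar> * infnorm x)"
      by (intro sum_mono) (simp add: abs_mult mult_left_mono component_le_infnorm_cart)
    finally show ?thesis by (simp add: sum_distrib_right)
  qed
  then have "l1_norm (A *v x) \<le> (\<Sum>i\<in>UNIV. (\<Sum>j\<in>UNIV. \<bar>A $ i $ j\<bar>) * infnorm x)"
    unfolding l1_norm_def by (intro sum_mono)
  then show "l1_norm (A *v x) / infnorm x \<le> (\<Sum>i\<in>UNIV. \<Sum>j\<in>UNIV. \<bar>A $ i $ j\<bar>)"
    using pos by (simp add: sum_distrib_right pos_divide_le_eq)
qed

lemma finite_vec_components:
  assumes "finite S"
  shows "finite {v :: 'a ^ 'n. \<forall>i. v $ i \<in> S}"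
proof (rule finite_subset)
  show "finite (vec_lambda ` (PiE (UNIV :: 'n set) (\<lambda>_. S)))"
    using assms by (intro finite_imageI finite_PiE) auto
  show "{v. \<forall>i. v $ i \<in> S} \<subseteq> vec_lambda ` (PiE (UNIV :: 'n set) (\<lambda>_. S))"
  proof
    fix v :: "'a ^ 'n"
    assume "v \<in> {v. \<forall>i. v $ i \<in> S}"
    then show "v \<in> vec_lambda ` (PiE (UNIV :: 'n set) (\<lambda>_. S))"
      by (intro image_eqI[of _ _ "vec_nth v"]) auto
  qed
qed

lemma finite_hadamard_matrices: "finite {A :: real ^ 'n ^ 'n. hadamard_matrix A}"
proof -
  have "finite {A :: real ^ 'n ^ 'n. \<forall>i. A $ i \<in> {v. \<forall>j. v $ j \<in> {1, -1}}}"
    by (intro finite_vec_components) simp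
  then show ?thesis
    by (rule finite_subset[rotated]) (auto simp: hadamard_matrix_def)
qed

lemma finite_hadamard_class: "finite (hadamard_class A)"
  by (rule finite_subset[OF _ finite_hadamard_matrices]) (auto simp: hadamard_class_def)

lemma self_in_hadamard_class: "hadamard_matrix A \<Longrightarrow> A \<in> hadamard_class A"
  by (simp add: hadamard_class_def hadamard_equiv.refl)

end

theory Submission
  imports Defs
begin

text \<open>Both sides are the maximum of \<open>\<Sum>i j. r i * s j * H i j\<close> over sign vectors \<open>r\<close> and \<open>s\<close>.
  The excess of a matrix is at most its norm, since it is at most the \<open>l1\<close>-norm of the image of
  the all-ones vector, and the norm does not change under the equivalence moves.
  Conversely, if the entries of \<open>y\<close> lie in \<open>[-1, 1]\<close>, then choosing for \<open>r\<close> the signs of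
  the entries of \<open>H y\<close>, and for \<open>s\<close> the signs of those of the transposed matrix applied to \<open>r\<close>,
  gives \<open>l1_norm (H y) \<le> (\<Sum>i j. r i * s j * H i j)\<close>, the excess of a matrix equivalent to \<open>H\<close>.\<close>

text \<open>The product form also covers \<open>x = 0\<close>, which the supremum leaves out and
  where both sides vanish.\<close>

lemma l1_norm_matrix_vector_le:
  "l1_norm (A *v x) \<le> inf_one_norm A * infnorm x"
proof (cases "x = 0")
  case True
  then show ?thesis by (simp add: l1_norm_def infnorm_0)
next
  case False
  then have "l1_norm (A *v x) / infnorm x \<le> inf_one_norm A"
    unfolding inf_one_norm_def by (intro cSUP_upper inf_one_norm_bdd_above) simp
  with False show ?thesis by (simp add: infnorm_pos_lt pos_divide_le_eq)
qed

lemma infnorm_permute: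
  fixes x :: "real ^ 'n"
  assumes "p permutes UNIV"
  shows "infnorm (\<chi> j. x $ p j) = infnorm x"
proof -
  have "range (\<lambda>j. \<bar>x $ p j\<bar>) = (\<lambda>j. \<bar>x $ j\<bar>) ` range p"
    by (simp add: image_image)
  then show ?thesis
    using permutes_surj[OF assms] by (simp add: infnorm_eq_Max)
qed

text \<open>Row moves only permute or negate the coordinates of \<open>B *v x\<close>. Column moves
  can be shifted onto \<open>x\<close>, giving a vector \<open>y\<close> with the same
  \<open>infnorm\<close>; this is why the induction keeps \<open>x\<close> arbitrary.\<close>

lemma hadamard_equiv_l1_norm_le:
  fixes A B :: "real ^ 'n ^ 'n"
  assumes "hadamard_equiv A B"
  shows "l1_norm (B *v x) \<le> inf_one_norm A * infnorm x"
  using assms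
proof (induction arbitrary: x)
  case refl
  show ?case by (rule l1_norm_matrix_vector_le)
next
  case (permute_rows B p)
  have "l1_norm ((\<chi> i j. B $ p i $ j) *v x) = (\<Sum>i\<in>UNIV. \<bar>(B *v x) $ p i\<bar>)"
    by (simp add: l1_norm_def matrix_vector_mult_def)
  also have "\<dots> = l1_norm (B *v x)"
    unfolding l1_norm_def by (rule sum.permute[OF permute_rows.hyps(2), symmetric, unfolded comp_def])
  finally show ?case using permute_rows.IH[of x] by simp
next
  case (permute_columns B p)
  \<comment> \<open>The inverse is forced by reindexing: \<open>y $ p j = x $ j\<close>.\<close>
  define y where "y = (\<chi> j. x $ inv p j)"
  have "(\<Sum>j\<in>UNIV. B $ i $ p j * x $ j) = (\<Sum>j\<in>UNIV. B $ i $ j * y $ j)" for i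
    using sum.permute[OF permute_columns.hyps(2), of "\<lambda>j. B $ i $ j * y $ j"]
    by (simp add: y_def comp_def permutes_inverses(2)[OF permute_columns.hyps(2)])
  then have "(\<chi> i j. B $ i $ p j) *v x = B *v y"
    by (simp add: matrix_vector_mult_def)
  moreover have "infnorm y = infnorm x"
    unfolding y_def by (rule infnorm_permute[OF permutes_inv[OF permute_columns.hyps(2)]])
  ultimately show ?case using permute_columns.IH[of y] by simp
next
  case (negate_row B k)
  have "\<bar>((\<chi> i j. if i = k then - B $ i $ j else B $ i $ j) *v x) $ i\<bar> = \<bar>(B *v x) $ i\<bar>" for i
    by (cases "i = k") (simp_all add: matrix_vector_mult_def sum_negf)
  then show ?case using negate_row.IH[of x] by (simp add: l1_norm_def)
next
  case (negate_column B k)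
  define y where "y = (\<chi> j. if j = k then - x $ j else x $ j)"
  have "(\<chi> i j. if j = k then - B $ i $ j else B $ i $ j) *v x = B *v y"
    by (auto simp: matrix_vector_mult_def y_def vec_eq_iff intro!: sum.cong)
  moreover have "infnorm y = infnorm x"
    unfolding infnorm_eq_Max y_def by (intro arg_cong[where f = Max] image_cong) auto
  ultimately show ?case using negate_column.IH[of y] by simp
qed

lemma hadamard_equiv_excess_le:
  fixes A B :: "real ^ 'n ^ 'n"
  assumes "hadamard_equiv A B"
  shows "excess B \<le> inf_one_norm A"
proof -
  have "excess B \<le> l1_norm (B *v 1)"
    unfolding excess_def l1_norm_def by (intro sum_mono) (simp add: matrix_vector_mult_def)
  also have "\<dots> \<le> inf_one_norm A * infnorm (1 :: real ^ 'n)"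
    by (rule hadamard_equiv_l1_norm_le[OF assms])
  also have "infnorm (1 :: real ^ 'n) = 1" by (simp add: infnorm_eq_Max)
  finally show ?thesis by simp
qed

text \<open>Iterates the single-row move over \<open>S\<close>; since \<open>k \<notin> S\<close> in
  the induction step, no row is negated twice.\<close>

lemma hadamard_equiv_negate_rows:
  fixes A B :: "real ^ 'n ^ 'n"
  assumes "hadamard_equiv A B" "finite S"
  shows "hadamard_equiv A (\<chi> i j. if i \<in> S then - B $ i $ j else B $ i $ j)"
  using assms(2)
proof (induction S)
  case empty
  then show ?case using assms(1) by simp
next
  case (insert k S)
  show ?case
    by (rule back_subst[of "hadamard_equiv A", OF hadamard_equiv.negate_row[OF insert.IH, of k]])
      (use insert.hyps in \<open>auto simp: vec_eq_iff\<close>)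
qed

lemma hadamard_equiv_negate_columns:
  fixes A B :: "real ^ 'n ^ 'n"
  assumes "hadamard_equiv A B" "finite S"
  shows "hadamard_equiv A (\<chi> i j. if j \<in> S then - B $ i $ j else B $ i $ j)"
  using assms(2)
proof (induction S)
  case empty
  then show ?case using assms(1) by simp
next
  case (insert k S)
  show ?case
    by (rule back_subst[of "hadamard_equiv A", OF hadamard_equiv.negate_column[OF insert.IH, of k]])
      (use insert.hyps in \<open>auto simp: vec_eq_iff\<close>)
qed

text \<open>Every sign pattern \<open>r i * s j\<close> is reached by negating the rows with
  \<open>r i = -1\<close> and then the columns with \<open>s j = -1\<close>.\<close>

lemma hadamard_class_scale:
  fixes A :: "real ^ 'n ^ 'n" and r s :: "'n \<Rightarrow> real"
  assumes "hadamard_matrix A"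
    and r: "\<And>i. r i \<in> {1, -1}" and s: "\<And>j. s j \<in> {1, -1}"
  shows "(\<chi> i j. r i * s j * A $ i $ j) \<in> hadamard_class A"
proof -
  let ?B = "\<chi> i j. r i * s j * A $ i $ j"
  have "hadamard_equiv A
      (\<chi> i j. if j \<in> {j. s j = -1}
        then - (\<chi> i j. if i \<in> {i. r i = -1} then - A $ i $ j else A $ i $ j) $ i $ j
        else (\<chi> i j. if i \<in> {i. r i = -1} then - A $ i $ j else A $ i $ j) $ i $ j)"
    by (intro hadamard_equiv_negate_columns hadamard_equiv_negate_rows hadamard_equiv.refl) simp_all
  also have "\<dots> = ?B"
  proof -
    have "r i = 1 \<or> r i = -1" "s j = 1 \<or> s j = -1" for i j
      using r[of i] s[of j] by auto
    then show ?thesis by (simp add: vec_eq_iff) (metis mult_1 one_neq_neg_one)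
  qed
  finally have "hadamard_equiv A ?B" .
  moreover have "hadamard_matrix ?B"
    unfolding hadamard_matrix_def
  proof (intro conjI allI impI)
    show "?B $ i $ j \<in> {1, -1}" for i j
      using assms(1) r[of i] s[of j] by (force simp: hadamard_matrix_def)
    fix i k :: 'n
    assume "i \<noteq> k"
    then have "row i A \<bullet> row k A = 0"
      using assms(1) by (simp add: hadamard_matrix_def orthogonal_def)
    \<comment> \<open>In the inner product of two rows the column signs occur squared and cancel, so
      only the constant factor \<open>r i * r k\<close> remains.\<close>
    moreover have "s j * s j = 1" for j using s[of j] by auto
    then have "(r i * s j * A $ i $ j) * (r k * s j * A $ k $ j) =
        r i * r k * (A $ i $ j * A $ k $ j)" for j
      by (metis (no_types, opaque_lifting) mult.assoc mult.left_commute mult_1)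
    then have "row i ?B \<bullet> row k ?B = r i * r k * (row i A \<bullet> row k A)"
      unfolding inner_vec_def row_def sum_distrib_left by (intro sum.cong) simp_all
    ultimately show "orthogonal (row i ?B) (row k ?B)"
      by (simp add: orthogonal_def)
  qed
  ultimately show ?thesis by (simp add: hadamard_class_def)
qed

text \<open>The factor \<open>infnorm x\<close> replaces scaling \<open>x\<close> into the unit
  cube. The witness \<open>B\<close> may depend on \<open>x\<close>.\<close>

lemma ex_excess_ge_l1_norm:
  fixes A :: "real ^ 'n ^ 'n"
  assumes "hadamard_matrix A"
  shows "\<exists>B\<in>hadamard_class A. l1_norm (A *v x) \<le> excess B * infnorm x"
proof -
  \<comment> \<open>Unlike \<open>sgn\<close>, \<open>sg\<close> sends 0 to 1, so that its values
    are always legitimate signs.\<close>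
  define sg :: "real \<Rightarrow> real" where "sg t = (if t < 0 then -1 else 1)" for t
  have sg: "sg t \<in> {1, -1}" and sg_abs: "sg t * t = \<bar>t\<bar>" for t
    by (auto simp: sg_def)
  define r where "r i = sg ((A *v x) $ i)" for i
  \<comment> \<open>These are the entries of the transposed matrix applied to \<open>r\<close>;
    exchanging the sums makes the expression linear in \<open>x\<close> with coefficients
    \<open>c j\<close>.\<close>
  define c where "c j = (\<Sum>i\<in>UNIV. r i * A $ i $ j)" for j
  have "l1_norm (A *v x) = (\<Sum>i\<in>UNIV. r i * (A *v x) $ i)"
    by (simp add: l1_norm_def r_def sg_abs)
  also have "\<dots> = (\<Sum>i\<in>UNIV. \<Sum>j\<in>UNIV. r i * A $ i $ j * x $ j)"
    by (simp add: matrix_vector_mult_def sum_distrib_left mult.assoc)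
  also have "\<dots> = (\<Sum>j\<in>UNIV. c j * x $ j)"
    unfolding c_def by (subst sum.swap) (simp add: sum_distrib_right)
  \<comment> \<open>A linear form on the cube of radius \<open>infnorm x\<close> is largest at the
    vertex whose signs are those of \<open>c\<close>.\<close>
  also have "\<dots> \<le> (\<Sum>j\<in>UNIV. \<bar>c j\<bar> * infnorm x)"
  proof (rule sum_mono)
    fix j
    have "c j * x $ j \<le> \<bar>c j\<bar> * \<bar>x $ j\<bar>" by (metis abs_ge_self abs_mult)
    also have "\<dots> \<le> \<bar>c j\<bar> * infnorm x"
      by (simp add: mult_left_mono component_le_infnorm_cart)
    finally show "c j * x $ j \<le> \<bar>c j\<bar> * infnorm x" .
  qed
  also have "\<dots> = (\<Sum>j\<in>UNIV. sg (c j) * c j) * infnorm x"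
    by (simp add: sg_abs sum_distrib_right)
  also have "(\<Sum>j\<in>UNIV. sg (c j) * c j) = (\<Sum>j\<in>UNIV. \<Sum>i\<in>UNIV. r i * sg (c j) * A $ i $ j)"
  proof (rule sum.cong)
    fix j
    have "sg (c j) * c j = sg (c j) * (\<Sum>i\<in>UNIV. r i * A $ i $ j)"
      by (simp only: c_def)
    then show "sg (c j) * c j = (\<Sum>i\<in>UNIV. r i * sg (c j) * A $ i $ j)"
      by (simp add: sum_distrib_left mult_ac)
  qed simp
  also have "\<dots> = excess (\<chi> i j. r i * sg (c j) * A $ i $ j)"
    unfolding excess_def by (subst sum.swap) simp
  finally show ?thesis
    using hadamard_class_scale[OF assms, of r "\<lambda>j. sg (c j)"] sg by (auto simp: r_def)
qed

theorem theorem3: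
  fixes H :: "real ^ 'n ^ 'n"
  assumes "hadamard_matrix H"
  shows "max_excess (hadamard_class H) = inf_one_norm H"
proof (rule antisym)
  have fin: "finite (excess ` hadamard_class H)"
    by (intro finite_imageI finite_hadamard_class)
  have "excess ` hadamard_class H \<noteq> {}"
    using self_in_hadamard_class[OF assms] by blast
  then show "max_excess (hadamard_class H) \<le> inf_one_norm H"
    unfolding max_excess_def using fin
    by (auto simp: hadamard_class_def intro: hadamard_equiv_excess_le)
  show "inf_one_norm H \<le> max_excess (hadamard_class H)"
    unfolding inf_one_norm_def
  proof (rule cSUP_least[OF inf_one_norm_nonempty])
    fix x :: "real ^ 'n"
    assume "x \<in> {x. x \<noteq> 0}"
    then have pos: "infnorm x > 0" by (simp add: infnorm_pos_lt)
    \<comment> \<open>\<open>B\<close> varies with \<open>x\<close>, but the maximum over the finite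
      class bounds the excess of every such \<open>B\<close>.\<close>
    obtain B where B: "B \<in> hadamard_class H" "l1_norm (H *v x) \<le> excess B * infnorm x"
      using ex_excess_ge_l1_norm[OF assms] by blast
    have "l1_norm (H *v x) / infnorm x \<le> excess B"
      using B(2) pos by (simp add: pos_divide_le_eq)
    also have "\<dots> \<le> max_excess (hadamard_class H)"
      unfolding max_excess_def using fin B(1) by (intro Max_ge) auto
    finally show "l1_norm (H *v x) / infnorm x \<le> max_excess (hadamard_class H)" .
  qed
qed

end
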